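(* For $n\ge3$ with $n\not\equiv2\pmod4$ and $k\ge3$, $$p_n(\Sigma^-_k)-p_n(\Sigma^-_{k-1})=C'(n,k)=L_k(n)-\sum_{i=2}^{k-1}\binom{n+k-i}{k-i}C'(n,i),$$ where $L_k(n)=\frac1n\sum_{d\mid n}\mu(d)k^{n/d}$ and $\mu$ is the Möbius function.
   Context: For $\sigma\in\{+,-\}^k$ ($k\ge2$), let $\mathcal W_k$ be the set of infinite words over $\{0,\dots,k-1\}$ with the linear order $\prec_\sigma$: for $s\neq t$, with $j$ the first index where $s_j\neq t_j$ and $c=|\{i<j:\sigma_{s_i}=-\}|$, $s\prec_\sigma t$ iff ($c$ even and $s_j<t_j$) or ($c$ odd and $s_j>t_j$). The signed shift $\Sigma_\sigma$ deletes the first letter of a word. Let $\mathcal W_{k,n}$ be the set of words $(s_1\dots s_n)^\infty$ with $s_1\dots s_n$ primitive (not a power of a shorter word). For $s\in\mathcal W_{k,n}$ let $\Pi_\sigma(s)\in\mathcal S_n$ be the permutation with $\Pi_\sigma(s)_i<\Pi_\sigma(s)_j$ iff $s_is_{i+1}\dots\prec_\sigma s_js_{j+1}\dots$. Let $\mathcal P_n(\Sigma_\sigma)=\{\Pi_\sigma(s):s\in\mathcal W_{k,n}\}$ and $p_n(\Sigma_\sigma)=|\mathcal P_n(\Sigma_\sigma)|/n$ (the number of classes of $\mathcal P_n(\Sigma_\sigma)$ under cyclic rotation). $\Sigma^-_k$ denotes the reverse $k$-shift $\Sigma_{-^k}$ (all signs $-$). $C'(n,i)$ denotes the number of cyclic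 permutations ($n$-cycles) in $\mathcal S_n$ with exactly $i-1$ ascents, an ascent of $\tau$ being an $i\in[n-1]$ with $\tau_i<\tau_{i+1}$. *)

theory Defs
  imports
    Complex_Main
    "HOL-Library.Stream"
    "HOL-Combinatorics.Permutations"
    "HOL-Combinatorics.Orbits"
    "HOL-Computational_Algebra.Squarefree"
    "HOL-Number_Theory.Cong"
begin

datatype sign = Plus | Minus

text \<open>A signature in \<open>{+,-}\<^sup>k\<close> is a list of length \<open>k\<close>, and the alphabet is \<open>{0,...,k-1}\<close>.
  Streams are indexed from 0: the letter written \<open>s\<^sub>i\<close> with \<open>i \<ge> 1\<close> is \<open>s !! (i - 1)\<close>.\<close>

definition minus_count :: "sign list \<Rightarrow> nat stream \<Rightarrow> nat \<Rightarrow> nat" where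
  "minus_count \<sigma> s j = card {i. i < j \<and> \<sigma> ! (s !! i) = Minus}"

definition signed_less :: "sign list \<Rightarrow> nat stream \<Rightarrow> nat stream \<Rightarrow> bool" where
  "signed_less \<sigma> s t \<longleftrightarrow>
     (\<exists>j. s !! j \<noteq> t !! j \<and> (\<forall>i<j. s !! i = t !! i) \<and>
        (even (minus_count \<sigma> s j) \<and> s !! j < t !! j \<or>
         odd (minus_count \<sigma> s j) \<and> s !! j > t !! j))"

definition primitive_word :: "'a list \<Rightarrow> bool" where
  "primitive_word u \<longleftrightarrow> u \<noteq> [] \<and> \<not> (\<exists>v m. length v < length u \<and> u = concat (replicate m v))"

definition periodic_words :: "nat \<Rightarrow> nat \<Rightarrow> nat stream set" where
  "periodic_words k n =
     {cycle u | u. length u = n \<and> set u \<subseteq> {..<k} \<and> primitive_word u}"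

text \<open>Permutations in \<open>S\<^sub>n\<close> are functions permuting \<open>{1..n}\<close>. The signed shift is \<open>stl\<close>, so the
  word \<open>s\<^sub>i s\<^sub>i\<^sub>+\<^sub>1 ...\<close> is its \<open>(i - 1)\<close>-st iterate \<open>sdrop (i - 1) s\<close>.\<close>

definition is_pattern :: "sign list \<Rightarrow> nat \<Rightarrow> nat stream \<Rightarrow> (nat \<Rightarrow> nat) \<Rightarrow> bool" where
  "is_pattern \<sigma> n s \<pi> \<longleftrightarrow> \<pi> permutes {1..n} \<and>
     (\<forall>i\<in>{1..n}. \<forall>j\<in>{1..n}.
        \<pi> i < \<pi> j \<longleftrightarrow> signed_less \<sigma> (sdrop (i - 1) s) (sdrop (j - 1) s))"

definition Pi_perm :: "sign list \<Rightarrow> nat \<Rightarrow> nat stream \<Rightarrow> (nat \<Rightarrow> nat)" where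
  "Pi_perm \<sigma> n s = (THE \<pi>. is_pattern \<sigma> n s \<pi>)"

definition realized_perms :: "sign list \<Rightarrow> nat \<Rightarrow> (nat \<Rightarrow> nat) set" where
  "realized_perms \<sigma> n = Pi_perm \<sigma> n ` periodic_words (length \<sigma>) n"

definition num_patterns :: "sign list \<Rightarrow> nat \<Rightarrow> real" where
  "num_patterns \<sigma> n = real (card (realized_perms \<sigma> n)) / real n"

definition reverse_signature :: "nat \<Rightarrow> sign list" where
  "reverse_signature k = replicate k Minus"

definition ascents :: "nat \<Rightarrow> (nat \<Rightarrow> nat) \<Rightarrow> nat set" where
  "ascents n \<tau> = {i \<in> {1..<n}. \<tau> i < \<tau> (i + 1)}"

definition cyc_asc :: "nat \<Rightarrow> nat \<Rightarrow> nat" where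
  "cyc_asc n i =
     card {\<tau>. \<tau> permutes {1..n} \<and> cyclic_on \<tau> {1..n} \<and> card (ascents n \<tau>) + 1 = i}"

definition moebius :: "nat \<Rightarrow> int" where
  "moebius d = (if squarefree d then (-1) ^ card (prime_factors d) else 0)"

definition lyndon_count :: "nat \<Rightarrow> nat \<Rightarrow> real" where
  "lyndon_count k n =
     (1 / real n) * (\<Sum>d | d dvd n. real_of_int (moebius d) * real k ^ (n div d))"


text \<open>The description in \<open>Pi_perm\<close> is proper: for words with a primitive period of length \<open>n\<close>,
  exactly one permutation is the pattern.\<close>

lemma signed_less_irrefl: "\<not> signed_less \<sigma> s s"
  by (auto simp: signed_less_def)

lemma minus_count_cong:
  assumes "\<forall>i<j. s !! i = t !! i"
  shows "minus_count \<sigma> s j = minus_count \<sigma> t j"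
proof -
  have "{i. i < j \<and> \<sigma> ! (s !! i) = Minus} = {i. i < j \<and> \<sigma> ! (t !! i) = Minus}"
    using assms by auto
  then show ?thesis by (simp add: minus_count_def)
qed

lemma signed_less_total:
  assumes "s \<noteq> t"
  shows "signed_less \<sigma> s t \<or> signed_less \<sigma> t s"
proof -
  define j where "j = (LEAST j. s !! j \<noteq> t !! j)"
  have "\<exists>j. s !! j \<noteq> t !! j"
    using assms by (metis stream_smap_nats stream.map_cong)
  then have j: "s !! j \<noteq> t !! j"
    unfolding j_def by (rule LeastI_ex)
  have eq: "\<forall>i<j. s !! i = t !! i"
    unfolding j_def using not_less_Least by blast
  have c: "minus_count \<sigma> s j = minus_count \<sigma> t j"
    using eq by (rule minus_count_cong)
  have eq': "\<forall>i<j. t !! i = s !! i"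
    using eq by simp
  consider "s !! j < t !! j" | "t !! j < s !! j"
    using j by linarith
  then show ?thesis
    unfolding signed_less_def using j eq eq' c by metis
qed

lemma signed_less_trans:
  assumes "signed_less \<sigma> s t" "signed_less \<sigma> t u"
  shows "signed_less \<sigma> s u"
proof -
  obtain j where j: "s !! j \<noteq> t !! j" "\<forall>i<j. s !! i = t !! i"
     "even (minus_count \<sigma> s j) \<and> s !! j < t !! j \<or> odd (minus_count \<sigma> s j) \<and> s !! j > t !! j"
    using assms(1) unfolding signed_less_def by blast
  obtain l where l: "t !! l \<noteq> u !! l" "\<forall>i<l. t !! i = u !! i"
     "even (minus_count \<sigma> t l) \<and> t !! l < u !! l \<or> odd (minus_count \<sigma> t l) \<and> t !! l > u !! l"
    using assms(2) unfolding signed_less_def by blast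
  show ?thesis
  proof (cases j l rule: linorder_cases)
    case less
    then have "u !! j = t !! j" "\<forall>i<j. s !! i = u !! i"
      using j l by auto
    then show ?thesis unfolding signed_less_def using j by metis
  next
    case equal
    have c: "minus_count \<sigma> s l = minus_count \<sigma> t l"
      using j(2) equal by (intro minus_count_cong) simp
    have "\<forall>i<l. s !! i = u !! i"
      using j l equal by auto
    moreover have "s !! l \<noteq> u !! l \<and>
       (even (minus_count \<sigma> s l) \<and> s !! l < u !! l \<or> odd (minus_count \<sigma> s l) \<and> s !! l > u !! l)"
      using j(3) l(3) c equal by auto
    ultimately show ?thesis unfolding signed_less_def by blast
  next
    case greater
    have c: "minus_count \<sigma> s l = minus_count \<sigma> t l"
      using j(2) greater by (intro minus_count_cong) simp
    have "s !! l = t !! l" "\<forall>i<l. s !! i = u !! i"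
      using j l greater by auto
    then show ?thesis unfolding signed_less_def using l c by metis
  qed
qed

lemma primitive_sdrop_inj:
  assumes "primitive_word u" "i < length u" "j < length u" "i < j"
  shows "sdrop i (cycle u) \<noteq> sdrop j (cycle u)"
proof
  let ?s = "cycle u" and ?n = "length u"
  assume eq: "sdrop i ?s = sdrop j ?s"
  have ne: "u \<noteq> []" using assms by auto
  define d where "d = j - i"
  define g where "g = gcd d ?n"
  have "sdrop (?n - i) (sdrop i ?s) = sdrop (?n - i) (sdrop j ?s)"
    using eq by simp
  then have "sdrop ?n ?s = sdrop (?n + d) ?s"
    using assms by (simp add: sdrop_add d_def add.commute)
  then have d: "sdrop d ?s = ?s"
    using ne by (metis sdrop_add sdrop_cycle_eq)
  have mult_d: "sdrop (d * m) ?s = ?s" for m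
    by (induction m) (simp_all add: sdrop_add[symmetric] d)
  have mult_n: "sdrop (?n * m) ?s = ?s" for m
    using ne by (induction m) (simp_all add: sdrop_add[symmetric])
  have d0: "d \<noteq> 0" using assms by (simp add: d_def)
  obtain x y where "d * x = ?n * y + g"
    using bezout_nat[OF d0] unfolding g_def by blast
  then have per: "sdrop g ?s = ?s"
    by (metis mult_d mult_n sdrop_add)
  have g: "g > 0" "g \<le> d" "d < ?n" "g dvd ?n"
    using assms d0 by (auto simp: g_def d_def intro: dvd_imp_le)
  define v where "v = stake g ?s"
  have len: "length v = g" by (simp add: v_def)
  have pow: "stake (g * m) ?s = concat (replicate m v)" for m
  proof (induction m)
    case (Suc m)
    have "stake (g * Suc m) ?s = stake g ?s @ stake (g * m) (sdrop g ?s)"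
      by (simp add: stake_add)
    then show ?case using Suc per by (simp add: v_def)
  qed simp
  have "u = stake ?n ?s" using ne by simp
  also have "\<dots> = concat (replicate (?n div g) v)"
    using pow[of "?n div g"] g by simp
  finally have "u = concat (replicate (?n div g) v)" .
  then show False
    using assms(1) g len unfolding primitive_word_def by (metis le_less_trans)
qed

lemma ex1_is_pattern:
  assumes "s \<in> periodic_words k n"
  shows "\<exists>!\<pi>. is_pattern \<sigma> n s \<pi>"
proof -
  obtain u where u: "s = cycle u" "length u = n" "primitive_word u"
    using assms by (auto simp: periodic_words_def)
  let ?r = "\<lambda>i j. signed_less \<sigma> (sdrop (i - 1) s) (sdrop (j - 1) s)"
  have tot: "?r i j \<or> ?r j i" if "i \<in> {1..n}" "j \<in> {1..n}" "i \<noteq> j" for i j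
  proof (rule signed_less_total)
    have "i - 1 < j - 1 \<or> j - 1 < i - 1" "i - 1 < n" "j - 1 < n"
      using that by auto
    then show "sdrop (i - 1) s \<noteq> sdrop (j - 1) s"
      using primitive_sdrop_inj u by metis
  qed
  define B where "B i = {j \<in> {1..n}. ?r j i}" for i
  define \<pi> where "\<pi> i = (if i \<in> {1..n} then card (B i) + 1 else i)" for i
  have fin: "finite (B i)" for i by (simp add: B_def)
  have mono: "\<pi> i < \<pi> j" if "i \<in> {1..n}" "j \<in> {1..n}" "?r i j" for i j
  proof -
    have "B i \<subset> B j"
    proof
      show "B i \<subseteq> B j" unfolding B_def using that(3) signed_less_trans by blast
      show "B i \<noteq> B j" unfolding B_def using that signed_less_irrefl by blast
    qed
    then show ?thesis
      using that fin by (simp add: \<pi>_def psubset_card_mono)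
  qed
  have iff: "\<pi> i < \<pi> j \<longleftrightarrow> ?r i j" if "i \<in> {1..n}" "j \<in> {1..n}" for i j
    using mono[OF that] mono[OF that(2) that(1)] tot[OF that] by (metis less_asym less_irrefl)
  have inj: "inj_on \<pi> {1..n}"
    by (rule inj_onI) (metis iff tot less_irrefl)
  have "\<pi> ` {1..n} \<subseteq> {1..n}"
  proof
    fix y assume "y \<in> \<pi> ` {1..n}"
    then obtain i where i: "i \<in> {1..n}" "y = card (B i) + 1" by (auto simp: \<pi>_def)
    have "i \<notin> B i" using signed_less_irrefl by (simp add: B_def)
    moreover have "B i \<subseteq> {1..n}" by (auto simp: B_def)
    ultimately have "B i \<subset> {1..n}" using i(1) by blast
    then have "card (B i) < n" using psubset_card_mono[of "{1..n}" "B i"] by simp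
    then show "y \<in> {1..n}" using i by simp
  qed
  then have "bij_betw \<pi> {1..n} {1..n}"
    using inj by (simp add: bij_betw_def endo_inj_surj)
  then have perm: "\<pi> permutes {1..n}"
    by (rule bij_imp_permutes) (simp only: \<pi>_def if_False)
  show ?thesis
  proof (rule ex1I)
    show "is_pattern \<sigma> n s \<pi>" using perm iff by (simp add: is_pattern_def)
  next
    fix \<rho> assume \<rho>: "is_pattern \<sigma> n s \<rho>"
    then have \<rho>p: "\<rho> permutes {1..n}" by (simp add: is_pattern_def)
    show "\<rho> = \<pi>"
    proof
      fix i
      show "\<rho> i = \<pi> i"
      proof (cases "i \<in> {1..n}")
        case False
        then show ?thesis using \<rho>p perm by (metis permutes_not_in)
      next
        case True
        then have mem: "\<rho> i \<in> {1..n}" using \<rho>p by (metis permutes_in_image)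
        have "\<rho> ` B i = {1..<\<rho> i}"
        proof
          show "\<rho> ` B i \<subseteq> {1..<\<rho> i}"
          proof
            fix y assume "y \<in> \<rho> ` B i"
            then obtain j where j: "j \<in> {1..n}" "?r j i" "y = \<rho> j" by (auto simp: B_def)
            have "\<rho> j \<in> {1..n}" using j(1) \<rho>p by (metis permutes_in_image)
            then show "y \<in> {1..<\<rho> i}" using j True \<rho> by (auto simp: is_pattern_def)
          qed
          show "{1..<\<rho> i} \<subseteq> \<rho> ` B i"
          proof
            fix y assume y: "y \<in> {1..<\<rho> i}"
            then have "y \<in> {1..n}" using mem by auto
            then obtain j where j: "j \<in> {1..n}" "y = \<rho> j"
              using permutes_image[OF \<rho>p] by blast
            then have "?r j i" using y True \<rho> by (auto simp: is_pattern_def)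
            then show "y \<in> \<rho> ` B i" using j by (auto simp: B_def)
          qed
        qed
        then have "card (B i) = \<rho> i - 1"
          using card_image[OF permutes_inj_on[OF \<rho>p, of "B i"]] by simp
        then show ?thesis using True mem by (simp add: \<pi>_def)
      qed
    qed
  qed
qed

end

theory Submission
  imports Defs
begin

text \<open>
  Let \<open>\<tau>\<close> be the \<open>n\<close>-cycle sending \<open>\<pi>\<^sub>i\<close> to \<open>\<pi>\<^sub>i\<^sub>+\<^sub>1\<close> (indices modulo \<open>n\<close>). A word has pattern \<open>\<pi>\<close> under
  the reverse shift iff its letters, listed by the rank of the corresponding suffix, increase weakly,
  and increase strictly at the ascents of \<open>\<tau>\<close>: two suffixes with the same first letter are ordered
  oppositely to their shifts. If \<open>\<tau>\<close> has \<open>i - 1\<close> ascents there are \<open>(n + k - i) choose (k - i)\<close> such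
  letter assignments. Each of them yields a primitive word when \<open>n mod 4\<close> is not \<open>2\<close>, because an even
  period \<open>D\<close> of the letters makes \<open>\<pi>\<close> monotone along multiples of \<open>D\<close>, hence \<open>n dvd D\<close>. Every
  \<open>n\<close>-cycle arises from exactly \<open>n\<close> permutations \<open>\<pi>\<close>, one for each starting value, so counting
  primitive words by pattern gives \<open>L\<^sub>k(n)\<close> as the sum of \<open>(n + k - i) choose (k - i)\<close> times
  \<open>C'(n,i)\<close> over \<open>i \<le> k\<close>, and \<open>p\<^sub>n\<close> as the sum of \<open>C'(n,i)\<close> over \<open>i \<le> k\<close>.
\<close>

section \<open>Moebius inversion and primitive words\<close>

text \<open>A new prime preserves squarefreeness and adds exactly one prime factor, so only the sign
  changes.\<close>

lemma moebius_mult_prime: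
  assumes "prime p" "\<not> p dvd d"
  shows "moebius (p * d) = - moebius d"
proof -
  have d: "d \<noteq> 0" using assms(2) by (metis dvd_0_right)
  have cop: "coprime p d" using assms by (simp add: prime_imp_coprime)
  have "squarefree (p * d) \<longleftrightarrow> squarefree d"
    using cop assms(1) by (metis squarefree_mult_coprime squarefree_multD(2) squarefree_prime)
  moreover have "prime_factors (p * d) = insert p (prime_factors d)"
    using assms(1) d by (simp add: prime_factors_product prime_factorization_prime prime_gt_0_nat)
  moreover have "p \<notin> prime_factors d" using assms(2) by (simp add: in_prime_factors_iff)
  ultimately show ?thesis by (simp add: moebius_def)
qed

text \<open>Only squarefree divisors contribute. For \<open>n > 1\<close>, fix a prime
  \<open>p\<close> dividing \<open>n\<close>: the divisors \<open>d\<close> prime to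
  \<open>p\<close> are paired with \<open>p * d\<close>, and each pair cancels.\<close>

lemma sum_moebius_divisors:
  assumes "n > 0"
  shows "(\<Sum>d | d dvd n. moebius d) = (if n = 1 then 1 else 0)"
proof (cases "n = 1")
  case True
  then show ?thesis by (simp add: moebius_def)
next
  case False
  then obtain p where p: "prime p" "p dvd n" using prime_factor_nat by blast
  have fin: "finite {d. d dvd n}" using assms by simp
  let ?S = "{d. d dvd n \<and> squarefree d \<and> \<not> p dvd d}"
  let ?T = "{d. d dvd n \<and> squarefree d \<and> p dvd d}"
  have bij: "bij_betw (\<lambda>d. p * d) ?S ?T"
  proof (rule bij_betwI[where g = "\<lambda>d. d div p"])
    show "(\<lambda>d. p * d) \<in> ?S \<rightarrow> ?T"
      using p by (auto intro!: squarefree_mult_coprime divides_mult squarefree_prime[of p]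
          simp: prime_imp_coprime)
    show "(\<lambda>d. d div p) \<in> ?T \<rightarrow> ?S"
    proof (rule Pi_I)
      fix d assume "d \<in> ?T"
      then obtain e where e: "d = p * e" "p * e dvd n" "squarefree (p * e)" by auto
      have "\<not> p dvd e"
      proof
        assume "p dvd e"
        then have "p ^ 2 dvd p * e" by (simp add: power2_eq_square)
        then show False using squarefreeD[OF e(3)] p(1) not_prime_unit by blast
      qed
      then show "d div p \<in> ?S"
        using e p(1) by (auto dest: squarefree_multD dvd_mult_right)
    qed
  qed (use p in auto)
  have "(\<Sum>d | d dvd n. moebius d) = sum moebius (?S \<union> ?T)"
    by (rule sum.mono_neutral_right[OF fin]) (auto simp: moebius_def)
  also have "\<dots> = sum moebius ?S + sum moebius ?T"
    by (rule sum.union_disjoint) (auto intro: finite_subset[OF _ fin])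
  also have "sum moebius ?T = (\<Sum>d\<in>?S. moebius (p * d))"
    using sum.reindex_bij_betw[OF bij, of moebius] by simp
  also have "\<dots> = - sum moebius ?S"
    using p by (simp add: moebius_mult_prime sum_negf)
  finally show ?thesis using False by simp
qed

text \<open>After exchanging the sums, the coefficient of \<open>f e\<close> is the Moebius sum over
  the divisors of \<open>n div e\<close>, which vanishes unless \<open>e = n\<close>.\<close>

lemma moebius_inversion:
  fixes f g :: "nat \<Rightarrow> int"
  assumes "n > 0" and g: "\<And>m. m > 0 \<Longrightarrow> g m = (\<Sum>e | e dvd m. f e)"
  shows "(\<Sum>d | d dvd n. moebius d * g (n div d)) = f n"
proof -
  have fin: "finite {d. d dvd n}" using assms(1) by simp
  have pos: "n div d > 0" if "d dvd n" for d
    using that assms(1) by (metis dvd_div_eq_0_iff gr0I)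
  have "(\<Sum>d | d dvd n. moebius d * g (n div d))
      = (\<Sum>d | d dvd n. \<Sum>e | e dvd n \<and> d * e dvd n. moebius d * f e)"
  proof (rule sum.cong[OF refl])
    fix d assume "d \<in> {d. d dvd n}"
    then have d: "d dvd n" by simp
    \<comment> \<open>The condition \<open>d * e dvd n\<close> is symmetric in \<open>d\<close> and
      \<open>e\<close>, so the order of summation can be exchanged.\<close>
    then have "{e. e dvd n div d} = {e. e dvd n \<and> d * e dvd n}"
      using assms(1) by (auto simp: dvd_div_iff_mult mult.commute elim: dvd_mult_right)
    then show "moebius d * g (n div d) = (\<Sum>e | e dvd n \<and> d * e dvd n. moebius d * f e)"
      using g[OF pos[OF d]] by (simp add: sum_distrib_left)
  qed
  also have "\<dots> = (\<Sum>e | e dvd n. \<Sum>d | d dvd n \<and> d * e dvd n. moebius d * f e)"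
    using sum.swap_restrict[OF fin fin, of "\<lambda>d e. moebius d * f e" "\<lambda>d e. d * e dvd n"] by simp
  also have "\<dots> = (\<Sum>e | e dvd n. if e = n then f e else 0)"
  proof (rule sum.cong[OF refl])
    fix e assume "e \<in> {e. e dvd n}"
    then have e: "e dvd n" by simp
    then have "{d. d dvd n \<and> d * e dvd n} = {d. d dvd n div e}"
      using assms(1) by (auto simp: dvd_div_iff_mult elim: dvd_mult_left)
    moreover have "n div e = 1 \<longleftrightarrow> e = n"
      using e assms(1) by (metis div_self dvd_div_mult_self mult_1 not_gr0)
    ultimately show "(\<Sum>d | d dvd n \<and> d * e dvd n. moebius d * f e) = (if e = n then f e else 0)"
      using sum_moebius_divisors[OF pos[OF e]] by (simp add: sum_distrib_right[symmetric])
  qed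
  also have "\<dots> = f n" using fin by simp
  finally show ?thesis .
qed

section \<open>Infinite repetitions and primitive roots\<close>

lemma snth_cycle: "u \<noteq> [] \<Longrightarrow> cycle u !! i = u ! (i mod length u)"
  by (metis hd_rotate_conv_nth mod_mod_trivial cycle.sel(1) sdrop_cycle sdrop_simps(1))

lemma stream_eq_iff_snth: "s = t \<longleftrightarrow> (\<forall>i. s !! i = t !! i)"
  by (metis stream_smap_nats stream.map_cong)

lemma length_concat_replicate: "length (concat (replicate m v)) = m * length v"
  by (induction m) auto

lemma cycle_concat_replicate:
  assumes "concat (replicate m v) \<noteq> []"
  shows "cycle (concat (replicate m v)) = cycle v"
proof -
  have v: "v \<noteq> []" using assms by auto
  let ?n = "m * length v"
  have n: "?n > 0" using assms by auto
  have eq: "concat (replicate m v) = stake ?n (cycle v)"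
    using v by simp
  have "cycle (concat (replicate m v)) !! i = cycle v !! i" for i
  proof -
    have "cycle (concat (replicate m v)) !! i = concat (replicate m v) ! (i mod ?n)"
      using snth_cycle[OF assms] by (simp add: length_concat_replicate)
    also have "\<dots> = cycle v !! (i mod ?n)"
      unfolding eq by (rule stake_nth) (use n in simp)
    also have "\<dots> = cycle v !! i"
      using v by (simp add: snth_cycle mod_mod_cancel)
    finally show ?thesis .
  qed
  then show ?thesis by (simp add: stream_eq_iff_snth)
qed

text \<open>Strong induction on the length: a word that is not primitive is a power of a shorter
  one, and a power of a power is again a power.\<close>

lemma primitive_root_exists:
  assumes "u \<noteq> []"
  shows "\<exists>v m. primitive_word v \<and> u = concat (replicate m v)"
  using assms
proof (induction "length u" arbitrary: u rule: less_induct)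
  case less
  show ?case
  proof (cases "primitive_word u")
    case True
    then show ?thesis by (metis append_Nil2 concat.simps replicate_0 replicate_Suc)
  next
    case False
    then obtain v m where v: "length v < length u" "u = concat (replicate m v)"
      using less.prems by (auto simp: primitive_word_def)
    then have "v \<noteq> []" using less.prems by auto
    then obtain w l where w: "primitive_word w" "v = concat (replicate l w)"
      using less.hyps v(1) by blast
    have "concat (replicate m (concat (replicate l w))) = concat (replicate (m * l) w)"
      by (induction m) (simp_all add: replicate_add)
    then show ?thesis using v w by blast
  qed
qed

text \<open>If one period were shorter, the infinite word would be fixed by a shift smaller than the
  longer primitive period, contradicting \<open>primitive_sdrop_inj\<close>.\<close>

lemma primitive_cycle_inj:
  assumes "primitive_word v" "primitive_word w" "cycle v = cycle w"
  shows "v = w"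
proof -
  have False if "primitive_word x" "primitive_word y" "cycle x = cycle y" "length x < length y"
    for x y :: "'a list"
  proof -
    have "x \<noteq> []" using that by (simp add: primitive_word_def)
    then have "sdrop 0 (cycle y) = sdrop (length x) (cycle y)"
      using that(3) by (metis sdrop.simps(1) sdrop_cycle_eq)
    then show False
      using primitive_sdrop_inj[OF that(2), of 0 "length x"] that(4) \<open>x \<noteq> []\<close> by (metis length_0_conv less_nat_zero_code not_gr0 length_greater_0_conv order.strict_trans)
  qed
  then have "length v = length w" using assms by (metis linorder_neqE_nat)
  then show ?thesis
    using assms by (metis primitive_word_def stake_cycle_eq)
qed

section \<open>Counting primitive words\<close>

definition primitive_words :: "nat \<Rightarrow> nat \<Rightarrow> nat list set" where
  "primitive_words k n = {u. length u = n \<and> set u \<subseteq> {..<k} \<and> primitive_word u}"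

lemma finite_primitive_words: "finite (primitive_words k n)"
  by (rule finite_subset[OF _ finite_lists_length_eq[of "{..<k}" n]])
     (auto simp: primitive_words_def)

text \<open>Every word of length \<open>n\<close> is a power of exactly one primitive word.
  Existence is \<open>primitive_root_exists\<close>; uniqueness holds because a power and its root
  have the same infinite repetition.\<close>

lemma power_eq_sum_card_primitive_words:
  assumes "n > 0"
  shows "k ^ n = (\<Sum>e | e dvd n. card (primitive_words k e))"
proof -
  let ?pw = "\<lambda>e v. concat (replicate (n div e) v)"
  have ne: "?pw e v \<noteq> [] \<and> length (?pw e v) = n"
    if "e dvd n" "v \<in> primitive_words k e" for e v
  proof -
    have "length (?pw e v) = n" using that by (simp add: length_concat_replicate primitive_words_def)
    then show ?thesis using assms by (cases "?pw e v") auto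
  qed
  have root: "v = w" if "e dvd n" "v \<in> primitive_words k e" "f dvd n" "w \<in> primitive_words k f"
    "?pw e v = ?pw f w" for e f v w
  proof -
    have "cycle v = cycle w"
      using cycle_concat_replicate ne that by metis
    then show ?thesis
      using primitive_cycle_inj that by (auto simp: primitive_words_def)
  qed
  have "{u. set u \<subseteq> {..<k} \<and> length u = n} = (\<Union>e\<in>{e. e dvd n}. ?pw e ` primitive_words k e)"
  proof (intro equalityI subsetI)
    fix u assume "u \<in> {u. set u \<subseteq> {..<k} \<and> length u = n}"
    then have u: "set u \<subseteq> {..<k}" "length u = n" by auto
    then obtain v m where v: "primitive_word v" "u = concat (replicate m v)"
      using primitive_root_exists assms by (metis length_greater_0_conv)
    have n: "n = m * length v" using u v by (simp add: length_concat_replicate)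
    then have "m > 0" "length v > 0" using assms by auto
    then have "set v \<subseteq> {..<k}" using u v by auto
    then have "v \<in> primitive_words k (length v)" using v by (simp add: primitive_words_def)
    moreover have "n div length v = m" using n \<open>length v > 0\<close> by simp
    ultimately have "u \<in> ?pw (length v) ` primitive_words k (length v)"
      using v(2) by blast
    then show "u \<in> (\<Union>e\<in>{e. e dvd n}. ?pw e ` primitive_words k e)"
      using n by (intro UN_I[of "length v"]) simp_all
  next
    fix u assume "u \<in> (\<Union>e\<in>{e. e dvd n}. ?pw e ` primitive_words k e)"
    then show "u \<in> {u. set u \<subseteq> {..<k} \<and> length u = n}"
      using ne by (auto simp: primitive_words_def)
  qed
  then have "k ^ n = card (\<Union>e\<in>{e. e dvd n}. ?pw e ` primitive_words k e)"
    using card_lists_length_eq[of "{..<k}" n] by simp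
  also have "\<dots> = (\<Sum>e | e dvd n. card (?pw e ` primitive_words k e))"
  proof (rule card_UN_disjoint)
    show "\<forall>i\<in>{e. e dvd n}. \<forall>j\<in>{e. e dvd n}. i \<noteq> j \<longrightarrow>
        ?pw i ` primitive_words k i \<inter> ?pw j ` primitive_words k j = {}"
    proof (intro ballI impI equals0I)
      fix i j u assume ij: "i \<in> {e. e dvd n}" "j \<in> {e. e dvd n}" "i \<noteq> j"
        and "u \<in> ?pw i ` primitive_words k i \<inter> ?pw j ` primitive_words k j"
      then obtain v w where "v \<in> primitive_words k i" "w \<in> primitive_words k j" "?pw i v = ?pw j w"
        by auto
      with ij show False using root[of i v j w] by (auto simp: primitive_words_def)
    qed
  qed (use assms finite_primitive_words in auto)
  also have "\<dots> = (\<Sum>e | e dvd n. card (primitive_words k e))"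
  proof (rule sum.cong[OF refl])
    fix e assume "e \<in> {e. e dvd n}"
    then show "card (?pw e ` primitive_words k e) = card (primitive_words k e)"
      using root by (intro card_image inj_onI) blast
  qed
  finally show ?thesis .
qed

text \<open>Moebius inversion of the divisor sum for \<open>k ^ n\<close>; the factor
  \<open>n\<close> clears the denominator in \<open>lyndon_count\<close>.\<close>

lemma card_primitive_words:
  assumes "n > 0"
  shows "real (card (primitive_words k n)) = real n * lyndon_count k n"
proof -
  have "int (card (primitive_words k n)) = (\<Sum>d | d dvd n. moebius d * int k ^ (n div d))"
    using moebius_inversion[OF assms, of "\<lambda>m. int (k ^ m)" "\<lambda>m. int (card (primitive_words k m))"]
    by (simp add: power_eq_sum_card_primitive_words flip: of_nat_sum of_nat_power)
  then have "real (card (primitive_words k n))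
      = real_of_int (\<Sum>d | d dvd n. moebius d * int k ^ (n div d))"
    by (metis of_int_of_nat_eq)
  then show ?thesis using assms by (simp add: lyndon_count_def)
qed

section \<open>Monotone labelings with prescribed strict steps\<close>

text \<open>The argument is the rank of a suffix and the value is its first letter. Extensionality
  makes each labeling a single function, so that counting is meaningful.\<close>

definition monotone_labelings :: "nat \<Rightarrow> nat \<Rightarrow> nat set \<Rightarrow> (nat \<Rightarrow> nat) set" where
  "monotone_labelings n k A =
     {f \<in> {1..n} \<rightarrow>\<^sub>E {..<k}. \<forall>a\<in>{1..<n}. f a \<le> f (a + 1) \<and> (a \<in> A \<longrightarrow> f a < f (a + 1))}"

lemma steps_mono_on_interval:
  fixes f :: "nat \<Rightarrow> nat"
  assumes "\<And>c. a \<le> c \<Longrightarrow> c < b \<Longrightarrow> f c \<le> f (c + 1)" "a \<le> b"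
  shows "f a \<le> f b"
  using assms(2,1)
proof (induction b rule: dec_induct)
  case (step m)
  then show ?case by (metis Suc_eq_plus1 less_SucI le_trans less_Suc_eq order_refl)
qed simp

lemma steps_strict_mono_on_interval:
  fixes f :: "nat \<Rightarrow> nat"
  assumes "\<And>c. a \<le> c \<Longrightarrow> c < b \<Longrightarrow> f c < f (c + 1)" "a < b"
  shows "f a < f b"
proof -
  have "f (a + 1) \<le> f b"
    by (rule steps_mono_on_interval[where f = "f"]) (use assms in \<open>auto intro: less_imp_le\<close>)
  then show ?thesis using assms(1)[of a] assms(2) by simp
qed

lemma steps_strict_antimono_on_interval:
  fixes f :: "nat \<Rightarrow> nat"
  assumes "\<And>c. a \<le> c \<Longrightarrow> c < b \<Longrightarrow> f (c + 1) < f c" "a < b"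
  shows "f b < f a"
proof -
  have "f b < f a" if "Suc a \<le> b"
    using that assms(1)
  proof (induction b rule: dec_induct)
    case base
    then show ?case by simp
  next
    case (step m)
    then have "f m < f a" "f (m + 1) < f m" by simp_all
    then show ?case by simp
  qed
  then show ?thesis using assms(2) by simp
qed

text \<open>Sorting the image recovers a strictly increasing map; this gives both injectivity and
  the size of the image when labelings are encoded as subsets.\<close>

lemma sorted_list_of_strict_mono_image:
  fixes h :: "nat \<Rightarrow> nat"
  assumes "\<And>a. a \<in> {1..<n} \<Longrightarrow> h a < h (a + 1)"
  shows "sorted_list_of_set (h ` {1..n}) = map h [1..<Suc n]"
proof -
  have lt: "h a < h b" if "a \<in> {1..n}" "b \<in> {1..n}" "a < b" for a b
    by (rule steps_strict_mono_on_interval[where f = "h"]) (use that assms in \<open>auto\<close>)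
  have "sorted_wrt (<) (map h [1..<Suc n])"
    unfolding sorted_wrt_map
    by (rule sorted_wrt_mono_rel[OF _ sorted_wrt_upt[of 1 "Suc n"]]) (use lt in auto)
  moreover have "set (map h [1..<Suc n]) = h ` {1..n}" by auto
  ultimately show ?thesis
    by (metis sorted_list_of_set.idem_if_sorted_distinct strict_sorted_iff)
qed

lemma card_Int_step:
  fixes A :: "nat set"
  assumes "a \<ge> 1"
  shows "card (A \<inter> {1..<a + 1}) = card (A \<inter> {1..<a}) + (if a \<in> A then 1 else 0)"
proof -
  have "A \<inter> {1..<a + 1} = (if a \<in> A then insert a (A \<inter> {1..<a}) else A \<inter> {1..<a})"
    using assms by (auto simp: less_Suc_eq)
  then show ?thesis by simp
qed

text \<open>Shifting \<open>f a\<close> down by the number of forced strict steps before \<open>a\<close> and up by \<open>a - 1\<close> makes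
  all steps strict and imposes nothing else, so labelings correspond to \<open>n\<close>-subsets.\<close>

lemma card_monotone_labelings:
  assumes "n \<ge> 1" "A \<subseteq> {1..<n}"
  shows "card (monotone_labelings n k A) = (n + k - 1 - card A) choose n"
proof -
  \<comment> \<open>The largest shifted value is \<open>f n + (n - 1) - card A\<close> with
    \<open>f n < k\<close>, hence strictly below \<open>N\<close>.\<close>
  define N where "N = n + k - 1 - card A"
  define c where "c a = card (A \<inter> {1..<a})" for a
  define h where "h f a = f a + (a - 1) - c a" for f :: "nat \<Rightarrow> nat" and a
  have c_step: "c (a + 1) = c a + (if a \<in> A then 1 else 0)" if "a \<ge> 1" for a
    unfolding c_def by (rule card_Int_step[OF that])
  \<comment> \<open>At most \<open>a - 1\<close> steps precede \<open>a\<close>, so the subtraction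
    in \<open>h\<close> never truncates.\<close>
  have c_le: "c a \<le> a - 1" for a
    unfolding c_def using card_mono[of "{1..<a}" "A \<inter> {1..<a}"] by simp
  have c_n: "c n = card A" unfolding c_def using assms(2) by (simp add: Int_absorb2)
  have h_step: "h f a < h f (a + 1)" if "f \<in> monotone_labelings n k A" "a \<in> {1..<n}" for f a
  proof -
    have "f a \<le> f (a + 1)" "a \<in> A \<longrightarrow> f a < f (a + 1)"
      using that by (auto simp: monotone_labelings_def)
    then show ?thesis
      using c_step[of a] c_le[of a] that(2) by (auto simp: h_def split: if_splits)
  qed
  have sl: "sorted_list_of_set (h f ` {1..n}) = map (h f) [1..<Suc n]"
    if "f \<in> monotone_labelings n k A" for f
    using h_step that by (intro sorted_list_of_strict_mono_image)
  have bij: "bij_betw (\<lambda>f. h f ` {1..n}) (monotone_labelings n k A) {T. T \<subseteq> {..<N} \<and> card T = n}"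
    unfolding bij_betw_def
  proof
    show "inj_on (\<lambda>f. h f ` {1..n}) (monotone_labelings n k A)"
    proof (rule inj_onI)
      fix f g assume f: "f \<in> monotone_labelings n k A" and g: "g \<in> monotone_labelings n k A"
        and "h f ` {1..n} = h g ` {1..n}"
      then have "map (h f) [1..<Suc n] = map (h g) [1..<Suc n]" using sl by metis
      then have eq: "h f a = h g a" if "a \<in> {1..n}" for a
        using that by (simp add: map_eq_conv del: upt_Suc)
      have "f a = g a" if "a \<in> {1..n}" for a
        using eq[OF that] c_le[of a] that by (simp add: h_def) linarith
      then show "f = g"
        using f g by (intro PiE_ext[of f "{1..n}" "\<lambda>_. {..<k}" g]) (auto simp: monotone_labelings_def)
    qed
  next
    show "(\<lambda>f. h f ` {1..n}) ` monotone_labelings n k A = {T. T \<subseteq> {..<N} \<and> card T = n}"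
    proof (intro equalityI subsetI)
      fix T assume "T \<in> (\<lambda>f. h f ` {1..n}) ` monotone_labelings n k A"
      then obtain f where f: "f \<in> monotone_labelings n k A" and T: "T = h f ` {1..n}" by blast
      have "card T = n"
        using sl[OF f] T by (metis length_map length_upt diff_Suc_1 length_sorted_list_of_set)
      moreover have "h f a < N" if "a \<in> {1..n}" for a
      proof -
        have "h f a \<le> h f n"
          by (rule steps_mono_on_interval[where f = "h f"]) (use that h_step[OF f] in \<open>auto intro: less_imp_le\<close>)
        moreover have "f n < k" using f assms(1) by (auto simp: monotone_labelings_def)
        ultimately show ?thesis using c_n c_le[of n] assms(1) by (simp add: h_def N_def)
      qed
      ultimately show "T \<in> {T. T \<subseteq> {..<N} \<and> card T = n}" using T by auto
    next
      fix T assume "T \<in> {T. T \<subseteq> {..<N} \<and> card T = n}"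
      then have T: "T \<subseteq> {..<N}" "card T = n" "finite T" using finite_subset by auto
      define g where "g a = sorted_list_of_set T ! (a - 1)" for a
      have g_step: "g a < g (a + 1)" if "a \<in> {1..<n}" for a
      proof -
        have "sorted_wrt (<) (sorted_list_of_set T)" by simp
        then show ?thesis unfolding g_def using that T(2) by (auto simp: sorted_wrt_iff_nth_less)
      qed
      have g_img: "g ` {1..n} = T"
      proof -
        have "T = set (sorted_list_of_set T)" using T by simp
        also have "\<dots> = (\<lambda>i. sorted_list_of_set T ! i) ` {..<n}"
          using T(2) by (auto simp: set_conv_nth)
        also have "{..<n} = (\<lambda>a. a - 1) ` {1..n}"
          by (auto simp: image_iff intro!: bexI[of _ "Suc _"])
        finally show ?thesis by (simp add: image_image g_def)
      qed
      \<comment> \<open>This bound makes the subtraction in the following definition of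
        \<open>f\<close> exact.\<close>
      have g_ge: "a - 1 \<le> g a" if "1 \<le> a" "a \<le> n" for a
        using that
      proof (induction a rule: dec_induct)
        case (step m)
        then show ?case using g_step[of m] by auto
      qed simp
      \<comment> \<open>The inverse of the shift \<open>h\<close>: a strict step of \<open>g\<close>
        becomes a weak one, and \<open>c\<close> restores strictness at the elements of
        \<open>A\<close>.\<close>
      define f where "f = (\<lambda>a\<in>{1..n}. g a - (a - 1) + c a)"
      have f_step: "f a \<le> f (a + 1) \<and> (a \<in> A \<longrightarrow> f a < f (a + 1))" if "a \<in> {1..<n}" for a
        using that g_step[OF that] g_ge[of a] g_ge[of "a + 1"] c_step[of a]
        by (auto simp: f_def)
      have "f a < k" if "a \<in> {1..n}" for a
      proof -
        have "f a \<le> f n"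
          by (rule steps_mono_on_interval[where f = "f"]) (use that f_step in \<open>auto\<close>)
        moreover have "g n < N" using g_img T(1) assms(1)
          by (metis atLeastAtMost_iff image_eqI lessThan_iff order_refl subsetD)
        ultimately show ?thesis
          using assms(1) c_n c_le[of n] g_ge[of n] by (simp add: f_def N_def)
      qed
      then have "f \<in> monotone_labelings n k A"
        using f_step by (auto simp: monotone_labelings_def f_def)
      moreover have "h f a = g a" if "a \<in> {1..n}" for a
        using that g_ge[of a] c_le[of a] by (simp add: h_def f_def)
      then have "h f ` {1..n} = T" using g_img by (metis image_cong)
      ultimately show "T \<in> (\<lambda>f. h f ` {1..n}) ` monotone_labelings n k A" by blast
    qed
  qed
  then show ?thesis
    using bij_betw_same_card[OF bij] n_subsets[of "{..<N}" n] by (simp add: N_def)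
qed

section \<open>Words with a given pattern\<close>

lemma monotone_labelings_le:
  assumes "f \<in> monotone_labelings n k A" "1 \<le> a" "a \<le> b" "b \<le> n"
  shows "f a \<le> f b"
  by (rule steps_mono_on_interval[where f = f]) (use assms in \<open>auto simp: monotone_labelings_def\<close>)

text \<open>Equal labels at the ends force equal labels throughout, so no step between them is an
  ascent; injectivity turns each step into a strict descent.\<close>

lemma equal_labels_antimono:
  assumes f: "f \<in> monotone_labelings n k (ascents n \<tau>)" and inj: "inj_on \<tau> {1..n}"
    and ab: "1 \<le> a" "a < b" "b \<le> n" and eq: "f a = f b"
  shows "\<tau> b < \<tau> a"
proof (rule steps_strict_antimono_on_interval[where f = \<tau> and a = a and b = b])
  fix c assume c: "a \<le> c" "c < b"
  have "f a \<le> f c" "f (c + 1) \<le> f b"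
    using ab c by (auto intro!: monotone_labelings_le[OF f])
  then have "\<not> f c < f (c + 1)" using eq by simp
  then have "c \<notin> ascents n \<tau>" using f ab c by (auto simp: monotone_labelings_def)
  moreover have "\<tau> c \<noteq> \<tau> (c + 1)" using inj ab c by (auto dest: inj_onD)
  ultimately show "\<tau> (c + 1) < \<tau> c" using ab c by (auto simp: ascents_def)
qed (rule ab)

section \<open>The signed order of the reverse shift\<close>

lemma signed_less_reverse_iff:
  assumes "sset s \<subseteq> {..<k}"
  shows "signed_less (reverse_signature k) s t \<longleftrightarrow>
     (\<exists>j. (\<forall>i<j. s !! i = t !! i) \<and> (if even j then s !! j < t !! j else t !! j < s !! j))"
proof -
  have "s !! i < k" for i using assms snth_sset by blast
  \<comment> \<open>Since all letters are below \<open>k\<close>, every lookup in the signature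
    yields \<open>Minus\<close>, and the parity of the count is the parity of the index.\<close>
  then have "{i. i < j \<and> reverse_signature k ! (s !! i) = Minus} = {..<j}" for j
    by (auto simp: reverse_signature_def)
  then have "minus_count (reverse_signature k) s j = j" for j
    by (simp add: minus_count_def)
  then show ?thesis unfolding signed_less_def by (metis nat_neq_iff)
qed

lemma signed_less_reverse_shd:
  assumes "sset s \<subseteq> {..<k}" "signed_less (reverse_signature k) s t"
  shows "shd s \<le> shd t"
proof -
  obtain j where j: "\<forall>i<j. s !! i = t !! i" "if even j then s !! j < t !! j else t !! j < s !! j"
    using assms signed_less_reverse_iff by blast
  then show ?thesis by (cases j) auto
qed

text \<open>Deleting a common first letter moves the first difference down by one index, which
  switches its parity and reverses the comparison.\<close>

lemma signed_less_reverse_stl: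
  assumes "sset s \<subseteq> {..<k}" "sset t \<subseteq> {..<k}" "signed_less (reverse_signature k) s t"
    "shd s = shd t"
  shows "signed_less (reverse_signature k) (stl t) (stl s)"
proof -
  obtain j where j: "\<forall>i<j. s !! i = t !! i" "if even j then s !! j < t !! j else t !! j < s !! j"
    using assms signed_less_reverse_iff by blast
  then obtain l where l: "j = Suc l" using assms(4) by (cases j) auto
  have "sset (stl t) \<subseteq> {..<k}" using assms(2) by (metis stl_sset subset_iff)
  moreover have "\<forall>i<l. stl t !! i = stl s !! i" using j(1) l by (metis Suc_mono snth.simps(2))
  moreover have "if even l then stl t !! l < stl s !! l else stl s !! l < stl t !! l"
    using j(2) l by auto
  ultimately show ?thesis using signed_less_reverse_iff by blast
qed

section \<open>One-line notation read as a cycle\<close>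

definition entry :: "nat \<Rightarrow> (nat \<Rightarrow> nat) \<Rightarrow> nat \<Rightarrow> nat" where
  "entry n \<pi> i = \<pi> (i mod n + 1)"

text \<open>The cycle \<tau> obtained by reading the one-line notation of \<pi> as cycle notation.
  As \<open>inv \<pi> a\<close> is a 1-based position, \<open>mod n + 1\<close> is its cyclic
  successor.\<close>

definition one_line_cycle :: "nat \<Rightarrow> (nat \<Rightarrow> nat) \<Rightarrow> nat \<Rightarrow> nat" where
  "one_line_cycle n \<pi> a = (if a \<in> {1..n} then \<pi> (inv \<pi> a mod n + 1) else a)"

text \<open>Each position receives the label of the rank that \<pi> gives to the suffix starting
  there.\<close>

definition labeled_word :: "nat \<Rightarrow> (nat \<Rightarrow> nat) \<Rightarrow> (nat \<Rightarrow> nat) \<Rightarrow> nat list" where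
  "labeled_word n \<pi> f = map (\<lambda>i. f (entry n \<pi> i)) [0..<n]"

context
  fixes n :: nat and \<pi> :: "nat \<Rightarrow> nat"
  assumes n_pos: "n \<ge> 1" and perm: "\<pi> permutes {1..n}"
begin

lemma entry_in: "entry n \<pi> i \<in> {1..n}"
proof -
  have "i mod n + 1 \<in> {1..n}" using n_pos by (simp add: Suc_leI)
  then show ?thesis unfolding entry_def by (simp only: permutes_in_image[OF perm])
qed

lemma entry_eq_iff: "entry n \<pi> i = entry n \<pi> j \<longleftrightarrow> i mod n = j mod n"
  using permutes_inj[OF perm] by (simp add: entry_def inj_eq)

lemma entry_mod: "entry n \<pi> (i mod n) = entry n \<pi> i"
  by (simp add: entry_def)

lemma entry_surj:
  assumes "a \<in> {1..n}"
  obtains i where "i < n" "entry n \<pi> i = a"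
proof -
  have a: "inv \<pi> a \<in> {1..n}" "\<pi> (inv \<pi> a) = a"
    using perm assms by (metis permutes_in_image permutes_inv, metis permutes_inverses(1))
  then have "inv \<pi> a - 1 < n" "entry n \<pi> (inv \<pi> a - 1) = a" by (auto simp: entry_def)
  then show ?thesis by (rule that)
qed

lemma one_line_cycle_entry: "one_line_cycle n \<pi> (entry n \<pi> i) = entry n \<pi> (i + 1)"
proof -
  have "one_line_cycle n \<pi> (entry n \<pi> i) = \<pi> ((i mod n + 1) mod n + 1)"
    using entry_in[of i] perm by (simp add: one_line_cycle_def entry_def permutes_inverses(2))
  then show ?thesis by (simp add: entry_def mod_Suc_eq)
qed

lemma entry_periodic: "entry n \<pi> (i + n * m) = entry n \<pi> i"
  by (simp add: entry_def)

lemma inj_on_one_line_cycle: "inj_on (one_line_cycle n \<pi>) {1..n}"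
proof (rule inj_onI)
  fix a b assume ab: "a \<in> {1..n}" "b \<in> {1..n}" "one_line_cycle n \<pi> a = one_line_cycle n \<pi> b"
  obtain i j where i: "i < n" "entry n \<pi> i = a" and j: "j < n" "entry n \<pi> j = b"
    using ab entry_surj by metis
  have "(i + 1) mod n = (j + 1) mod n"
    using ab(3) i j one_line_cycle_entry entry_eq_iff by metis
  then have "i mod n = j mod n"
    by (metis Suc_eq_plus1 mod_Suc nat.inject nat.simps(3))
  then show "a = b" using i j entry_eq_iff by metis
qed

lemma length_labeled_word: "length (labeled_word n \<pi> f) = n"
  by (simp add: labeled_word_def)

lemma snth_cycle_labeled_word: "cycle (labeled_word n \<pi> f) !! i = f (entry n \<pi> i)"
proof -
  have "labeled_word n \<pi> f \<noteq> []" using length_labeled_word[of f] n_pos by auto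
  then have "cycle (labeled_word n \<pi> f) !! i = labeled_word n \<pi> f ! (i mod n)"
    by (simp add: snth_cycle length_labeled_word)
  then show ?thesis using n_pos by (simp add: labeled_word_def entry_mod)
qed

context
  fixes k f
  assumes f: "f \<in> monotone_labelings n k (ascents n (one_line_cycle n \<pi>))"
begin

text \<open>Among equally labeled ranks \<tau> reverses the order, so each advance past a common
  label flips the comparison.\<close>

lemma entry_order_flips:
  assumes "\<And>t. t < e \<Longrightarrow> f (entry n \<pi> (i + t)) = f (entry n \<pi> (j + t))"
    "entry n \<pi> i < entry n \<pi> j"
  shows "if even e then entry n \<pi> (i + e) < entry n \<pi> (j + e)
         else entry n \<pi> (j + e) < entry n \<pi> (i + e)"
  using assms(1)
proof (induction e)
  case 0
  then show ?case using assms(2) by simp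
next
  case (Suc e)
  have step: "entry n \<pi> (y + 1) < entry n \<pi> (x + 1)"
    if "entry n \<pi> x < entry n \<pi> y" "f (entry n \<pi> x) = f (entry n \<pi> y)" for x y
    using equal_labels_antimono[OF f inj_on_one_line_cycle _ that(1) _ that(2)]
      entry_in[of x] entry_in[of y] by (simp add: one_line_cycle_entry[simplified])
  have "f (entry n \<pi> (i + e)) = f (entry n \<pi> (j + e))" using Suc.prems by simp
  then show ?case
    using Suc step[of "i + e" "j + e"] step[of "j + e" "i + e"] by (auto split: if_splits)
qed

text \<open>An even number of flips preserves the comparison of ranks. If the ranks at positions 0
  and \<open>D\<close> differed, their comparison would propagate along all multiples of
  \<open>D\<close>, yet position \<open>n * D\<close> returns to the rank at 0.\<close>

lemma no_even_label_period:
  assumes per: "\<And>i. f (entry n \<pi> (i + D)) = f (entry n \<pi> i)" and "even D"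
  shows "n dvd D"
proof (rule ccontr)
  assume "\<not> n dvd D"
  then have ne: "entry n \<pi> 0 \<noteq> entry n \<pi> D"
    by (simp add: entry_eq_iff mod_eq_0_iff_dvd)
  have shift: "entry n \<pi> (i + D) < entry n \<pi> (j + D)"
    if "entry n \<pi> i < entry n \<pi> j" "\<And>t. f (entry n \<pi> (i + t)) = f (entry n \<pi> (j + t))" for i j
    using entry_order_flips[of D i j] that \<open>even D\<close> by simp
  have label_mult: "f (entry n \<pi> (m * D + t)) = f (entry n \<pi> t)" for m t
  proof (induction m)
    case (Suc m)
    then show ?case using per[of "m * D + t"] by (simp add: algebra_simps)
  qed simp
  \<comment> \<open>Positions that differ by a multiple of \<open>D\<close> see the same labels
    forever, as \<open>shift\<close> requires.\<close>
  have label_shift: "f (entry n \<pi> (m * D + t)) = f (entry n \<pi> (l * D + t))" for m l t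
    using label_mult by metis
  have end_eq: "entry n \<pi> (n * D) = entry n \<pi> 0"
    using entry_periodic[of 0 D] by simp
  show False
  proof (cases "entry n \<pi> 0 < entry n \<pi> D")
    case True
    have "entry n \<pi> (m * D) < entry n \<pi> ((m + 1) * D)" for m
    proof (induction m)
      case (Suc m)
      then show ?case
        using shift[of "m * D" "(m + 1) * D", OF _ label_shift] by (simp add: algebra_simps)
    qed (use True in simp)
    then have "entry n \<pi> (0 * D) < entry n \<pi> (n * D)"
      by (rule steps_strict_mono_on_interval[where f = "\<lambda>m. entry n \<pi> (m * D)"]) (use n_pos in simp)
    then show False using end_eq by simp
  next
    case False
    have "entry n \<pi> ((m + 1) * D) < entry n \<pi> (m * D)" for m
    proof (induction m)
      case (Suc m)
      then show ?case
        using shift[of "(m + 1) * D" "m * D", OF _ label_shift] by (simp add: algebra_simps)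
    qed (use False ne in simp)
    then have "entry n \<pi> (n * D) < entry n \<pi> (0 * D)"
      by (rule steps_strict_antimono_on_interval[where f = "\<lambda>m. entry n \<pi> (m * D)"]) (use n_pos in simp)
    then show False using end_eq by simp
  qed
qed

text \<open>A proper period \<open>d\<close> would make \<open>d\<close> or \<open>2 * d\<close> an even period that is not a multiple of \<open>n\<close>;
  the only exception is \<open>n = 2 * d\<close> with \<open>d\<close> odd.\<close>

lemma primitive_labeled_word:
  assumes "n mod 4 \<noteq> 2"
  shows "primitive_word (labeled_word n \<pi> f)"
proof (rule ccontr)
  assume "\<not> ?thesis"
  moreover have ne: "labeled_word n \<pi> f \<noteq> []" using length_labeled_word[of f] n_pos by auto
  ultimately obtain v m where v: "length v < n" "labeled_word n \<pi> f = concat (replicate m v)"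
    using length_labeled_word by (auto simp: primitive_word_def)
  define d where "d = length v"
  have n: "n = m * d" using v(2) length_labeled_word[of f] by (simp add: length_concat_replicate d_def)
  have vne: "v \<noteq> []" using ne v(2) by auto
  have "cycle (labeled_word n \<pi> f) = cycle v"
    using cycle_concat_replicate ne v(2) by metis
  then have per: "f (entry n \<pi> (i + d)) = f (entry n \<pi> i)" for i
    using snth_cycle_labeled_word[of f] snth_cycle[OF vne] by (metis d_def mod_add_self2)
  have per2: "f (entry n \<pi> (i + 2 * d)) = f (entry n \<pi> i)" for i
    using per[of "i + d"] per[of i] by (simp add: add.assoc mult_2)
  have d: "0 < d" "d < n" using vne v(1) by (auto simp: d_def)
  show False
  proof (cases "even d")
    case True
    then have "n dvd d" using no_even_label_period per by blast
    then show False using d by (simp add: nat_dvd_not_less)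
  next
    case False
    have "n dvd 2 * d" using no_even_label_period[of "2 * d"] per2 by simp
    then have "m dvd 2" using n d by simp
    then have "m = 1 \<or> m = 2" using prime_nat_iff two_is_prime_nat by blast
    then have "n = 2 * d" using n d by auto
    then have "n mod 4 = 2" using False by presburger
    then show False using assms by simp
  qed
qed

lemma set_labeled_word: "set (labeled_word n \<pi> f) \<subseteq> {..<k}"
  using f entry_in by (fastforce simp: labeled_word_def monotone_labelings_def)

text \<open>If a suffix were smaller without having smaller rank, the opposite rank comparison could
  be carried, with flips, to the first difference, where monotone labels contradict the letters.
  Primitivity makes distinct suffixes comparable, which yields the converse.\<close>

lemma labeled_word_pattern:
  assumes "primitive_word (labeled_word n \<pi> f)"
  shows "is_pattern (reverse_signature k) n (cycle (labeled_word n \<pi> f)) \<pi>"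
proof -
  let ?s = "cycle (labeled_word n \<pi> f)" and ?\<sigma> = "reverse_signature k"
  have ne: "labeled_word n \<pi> f \<noteq> []" using length_labeled_word[of f] n_pos by auto
  have sset: "sset (sdrop i ?s) \<subseteq> {..<k}" for i
    using sset_cycle[OF ne] set_labeled_word ne by (metis sdrop_cycle set_rotate sset_cycle rotate_is_Nil_conv)
  have less: "entry n \<pi> i < entry n \<pi> j" if sl: "signed_less ?\<sigma> (sdrop i ?s) (sdrop j ?s)" for i j
  proof (rule ccontr)
    assume not: "\<not> entry n \<pi> i < entry n \<pi> j"
    have letter: "sdrop i ?s !! t = f (entry n \<pi> (i + t))" for i t
      by (simp add: sdrop_snth snth_cycle_labeled_word)
    obtain e where e: "\<forall>t<e. f (entry n \<pi> (i + t)) = f (entry n \<pi> (j + t))"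
      and diff: "if even e then f (entry n \<pi> (i + e)) < f (entry n \<pi> (j + e))
        else f (entry n \<pi> (j + e)) < f (entry n \<pi> (i + e))"
      using sl unfolding signed_less_reverse_iff[OF sset] letter by blast
    have "i mod n \<noteq> j mod n"
    proof
      assume "i mod n = j mod n"
      then have "entry n \<pi> (i + e) = entry n \<pi> (j + e)"
        unfolding entry_eq_iff by (metis mod_add_left_eq)
      then show False using diff by (auto split: if_splits)
    qed
    then have "entry n \<pi> j < entry n \<pi> i" using not entry_eq_iff by (metis linorder_neqE_nat)
    then have flip: "if even e then entry n \<pi> (j + e) < entry n \<pi> (i + e)
         else entry n \<pi> (i + e) < entry n \<pi> (j + e)"
      using entry_order_flips[of e j i] e by simp
    have mono: "f (entry n \<pi> x) \<le> f (entry n \<pi> y)" if "entry n \<pi> x < entry n \<pi> y" for x y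
      using that entry_in[of x] entry_in[of y] by (intro monotone_labelings_le[OF f]) auto
    show False
      using flip diff mono[of "j + e" "i + e"] mono[of "i + e" "j + e"] by (auto split: if_splits)
  qed
  show ?thesis unfolding is_pattern_def
  proof (intro conjI ballI)
    fix i j assume i: "i \<in> {1..n}" and j: "j \<in> {1..n}"
    have ent: "entry n \<pi> (i - 1) = \<pi> i" "entry n \<pi> (j - 1) = \<pi> j"
      using i j by (auto simp: entry_def)
    have "sdrop (i - 1) ?s \<noteq> sdrop (j - 1) ?s" if "i \<noteq> j"
    proof -
      have "i - 1 < j - 1 \<or> j - 1 < i - 1" "i - 1 < n" "j - 1 < n" using that i j by auto
      then show ?thesis using primitive_sdrop_inj[OF assms] length_labeled_word[of f] by metis
    qed
    then show "\<pi> i < \<pi> j \<longleftrightarrow> signed_less ?\<sigma> (sdrop (i - 1) ?s) (sdrop (j - 1) ?s)"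
      using less[of "i - 1" "j - 1"] less[of "j - 1" "i - 1"] ent signed_less_total
      by (metis less_asym less_irrefl)
  qed (rule perm)
qed

end

text \<open>The label of a rank is the first letter of the suffix of that rank. First letters
  increase weakly, and a tie between consecutive ranks reverses the order of the shifted suffixes,
  so it cannot occur at an ascent.\<close>

lemma pattern_word_labeled:
  assumes u: "u \<in> primitive_words k n" and pat: "is_pattern (reverse_signature k) n (cycle u) \<pi>"
  shows "\<exists>f \<in> monotone_labelings n k (ascents n (one_line_cycle n \<pi>)). u = labeled_word n \<pi> f"
proof -
  let ?s = "cycle u" and ?\<sigma> = "reverse_signature k"
  have len: "length u = n" and ne: "u \<noteq> []" and setu: "set u \<subseteq> {..<k}"
    using u n_pos by (auto simp: primitive_words_def)
  have sset: "sset (sdrop i ?s) \<subseteq> {..<k}" for i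
    using setu ne by (metis sdrop_cycle set_rotate sset_cycle rotate_is_Nil_conv)
  have drop_mod: "sdrop (i mod n) ?s = sdrop i ?s" for i
    using ne len by (simp add: sdrop_cycle)
  have entry_less: "entry n \<pi> i < entry n \<pi> j \<longleftrightarrow> signed_less ?\<sigma> (sdrop i ?s) (sdrop j ?s)" for i j
  proof -
    have "i mod n + 1 \<in> {1..n}" "j mod n + 1 \<in> {1..n}" using n_pos by (auto simp: Suc_leI)
    then have "entry n \<pi> i < entry n \<pi> j \<longleftrightarrow>
        signed_less ?\<sigma> (sdrop (i mod n) ?s) (sdrop (j mod n) ?s)"
      using pat unfolding is_pattern_def entry_def by (metis add_diff_cancel_right')
    then show ?thesis by (simp add: drop_mod)
  qed
  \<comment> \<open>\<open>inv \<pi> a\<close> is a 1-based position, whereas list indices start at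
    0.\<close>
  define f where "f = (\<lambda>a\<in>{1..n}. u ! (inv \<pi> a - 1))"
  have f_entry: "f (entry n \<pi> i) = ?s !! i" for i
  proof -
    have "f (entry n \<pi> i) = u ! (i mod n)"
      using entry_in[of i] perm by (simp add: f_def entry_def permutes_inverses(2))
    then show ?thesis using ne len by (simp add: snth_cycle)
  qed
  have "f a < k" if "a \<in> {1..n}" for a
    using entry_surj[OF that] f_entry sset[of 0] by (metis snth_sset lessThan_iff subsetD sdrop.simps(1))
  moreover have "f a \<le> f (a + 1) \<and> (a \<in> ascents n (one_line_cycle n \<pi>) \<longrightarrow> f a < f (a + 1))"
    if a: "a \<in> {1..<n}" for a
  proof -
    have "a \<in> {1..n}" "a + 1 \<in> {1..n}" using a by auto
    then obtain i j where i: "entry n \<pi> i = a" and j: "entry n \<pi> j = a + 1"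
      by (metis entry_surj)
    have less: "signed_less ?\<sigma> (sdrop i ?s) (sdrop j ?s)" using entry_less[of i j] i j by simp
    have hd: "shd (sdrop i ?s) = f a" "shd (sdrop j ?s) = f (a + 1)"
      using f_entry i j by (metis sdrop_simps(1))+
    have "f a \<le> f (a + 1)" using signed_less_reverse_shd[OF sset less] hd by simp
    moreover have "a \<notin> ascents n (one_line_cycle n \<pi>)" if "f a = f (a + 1)"
    proof -
      have "signed_less ?\<sigma> (stl (sdrop j ?s)) (stl (sdrop i ?s))"
        using signed_less_reverse_stl[OF sset sset less] hd that by simp
      then have "entry n \<pi> (j + 1) < entry n \<pi> (i + 1)"
        unfolding entry_less by (simp add: sdrop_stl)
      then show ?thesis
        using one_line_cycle_entry[of i] one_line_cycle_entry[of j] i j by (simp add: ascents_def)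
    qed
    ultimately show ?thesis using le_neq_implies_less by blast
  qed
  ultimately have "f \<in> monotone_labelings n k (ascents n (one_line_cycle n \<pi>))"
    by (auto simp: monotone_labelings_def f_def)
  moreover have "u = labeled_word n \<pi> f"
    by (rule nth_equalityI) (use len ne in \<open>auto simp: labeled_word_def f_entry snth_cycle\<close>)
  ultimately show ?thesis by blast
qed

lemma inj_on_labeled_word: "inj_on (labeled_word n \<pi>) ({1..n} \<rightarrow>\<^sub>E {..<k})"
proof (rule inj_onI)
  fix f g assume f: "f \<in> {1..n} \<rightarrow>\<^sub>E {..<k}" and g: "g \<in> {1..n} \<rightarrow>\<^sub>E {..<k}"
    and eq: "labeled_word n \<pi> f = labeled_word n \<pi> g"
  have "f a = g a" if "a \<in> {1..n}" for a
    using entry_surj[OF that] snth_cycle_labeled_word eq by metis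
  then show "f = g" using f g by (intro PiE_ext[of f "{1..n}" "\<lambda>_. {..<k}" g]) auto
qed

text \<open>Labelings and words with pattern \<pi> are in bijection; the condition on
  \<open>n\<close> ensures that every labeled word is primitive.\<close>

lemma card_words_with_pattern:
  assumes "n mod 4 \<noteq> 2"
  shows "card {u \<in> primitive_words k n. is_pattern (reverse_signature k) n (cycle u) \<pi>}
       = (n + k - 1 - card (ascents n (one_line_cycle n \<pi>))) choose n"
proof -
  let ?M = "monotone_labelings n k (ascents n (one_line_cycle n \<pi>))"
  have "labeled_word n \<pi> ` ?M
      = {u \<in> primitive_words k n. is_pattern (reverse_signature k) n (cycle u) \<pi>}" (is "_ = ?W")
  proof
    show "labeled_word n \<pi> ` ?M \<subseteq> ?W"
    proof (rule image_subsetI)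
      fix f assume f: "f \<in> ?M"
      show "labeled_word n \<pi> f \<in> ?W"
        using labeled_word_pattern[OF f] primitive_labeled_word[OF f assms] set_labeled_word[OF f]
        by (simp add: primitive_words_def length_labeled_word)
    qed
    show "?W \<subseteq> labeled_word n \<pi> ` ?M" using pattern_word_labeled by blast
  qed
  moreover have "inj_on (labeled_word n \<pi>) ?M"
    by (rule inj_on_subset[OF inj_on_labeled_word[of k]]) (auto simp: monotone_labelings_def)
  ultimately have "card {u \<in> primitive_words k n. is_pattern (reverse_signature k) n (cycle u) \<pi>}
      = card ?M"
    using card_image by metis
  moreover have "ascents n (one_line_cycle n \<pi>) \<subseteq> {1..<n}" by (auto simp: ascents_def)
  ultimately show ?thesis by (simp only: card_monotone_labelings[OF n_pos])
qed

end

section \<open>Counting by cyclic permutations\<close>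

definition cyclic_perms :: "nat \<Rightarrow> (nat \<Rightarrow> nat) set" where
  "cyclic_perms n = {\<tau>. \<tau> permutes {1..n} \<and> cyclic_on \<tau> {1..n}}"

lemma finite_cyclic_perms: "finite (cyclic_perms n)"
  by (rule finite_subset[OF _ finite_permutations[of "{1..n}"]]) (auto simp: cyclic_perms_def)

lemma funpow_one_line_cycle:
  assumes "n \<ge> 1" "\<pi> permutes {1..n}"
  shows "(one_line_cycle n \<pi> ^^ i) (\<pi> 1) = entry n \<pi> i"
proof (induction i)
  case 0
  then show ?case by (simp add: entry_def)
next
  case (Suc i)
  then show ?case using one_line_cycle_entry[OF assms, of i] by simp
qed

lemma one_line_cycle_in_cyclic_perms:
  assumes "n \<ge> 1" "\<pi> permutes {1..n}"
  shows "one_line_cycle n \<pi> \<in> cyclic_perms n"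
proof -
  let ?\<tau> = "one_line_cycle n \<pi>"
  have "?\<tau> ` {1..n} \<subseteq> {1..n}"
  proof (rule image_subsetI)
    fix a assume "a \<in> {1..n}"
    then obtain i where "entry n \<pi> i = a" using entry_surj[OF assms] by metis
    then show "?\<tau> a \<in> {1..n}"
      using one_line_cycle_entry[OF assms, of i] entry_in[OF assms, of "i + 1"] by simp
  qed
  then have "bij_betw ?\<tau> {1..n} {1..n}"
    using inj_on_one_line_cycle[OF assms] by (simp add: bij_betw_def endo_inj_surj)
  then have perm: "?\<tau> permutes {1..n}"
    by (rule bij_imp_permutes) (simp only: one_line_cycle_def if_False)
  have "(?\<tau> ^^ n) (\<pi> 1) = \<pi> 1"
    using funpow_one_line_cycle[OF assms, of n] by (simp add: entry_def)
  then have "orbit ?\<tau> (\<pi> 1) = {(?\<tau> ^^ m) (\<pi> 1) |m. m < n}"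
    using assms(1) by (intro orbit_altdef_bounded) auto
  also have "\<dots> = {entry n \<pi> m |m. m < n}"
    by (simp only: funpow_one_line_cycle[OF assms])
  also have "\<dots> = {1..n}"
  proof (intro equalityI subsetI)
    fix a assume "a \<in> {1..n}"
    then show "a \<in> {entry n \<pi> m |m. m < n}" using entry_surj[OF assms] by blast
  qed (use entry_in[OF assms] in blast)
  finally have "orbit ?\<tau> (\<pi> 1) = {1..n}" .
  moreover have "\<pi> 1 \<in> {1..n}" using entry_in[OF assms, of 0] by (simp add: entry_def)
  ultimately have "cyclic_on ?\<tau> {1..n}" unfolding cyclic_on_def by metis
  then show ?thesis using perm by (simp add: cyclic_perms_def)
qed

text \<open>Up to the first return time \<open>funpow_dist1\<close>, the iterates run injectively
  through the orbit. The orbit is \<open>{1..n}\<close>, so this time is \<open>n\<close>.\<close>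

lemma cyclic_perm_funpow:
  assumes "\<tau> \<in> cyclic_perms n" "x \<in> {1..n}"
  shows "bij_betw (\<lambda>m. (\<tau> ^^ m) x) {0..<n} {1..n}" "(\<tau> ^^ n) x = x"
proof -
  have orb: "orbit \<tau> x = {1..n}"
    using assms by (intro orbit_cyclic_eq3) (auto simp: cyclic_perms_def)
  then have x: "x \<in> orbit \<tau> x" using assms by simp
  have bij: "bij_betw (\<lambda>m. (\<tau> ^^ m) x) {0..<funpow_dist1 \<tau> x x} {1..n}"
    unfolding bij_betw_def using inj_on_funpow_dist1[OF x] orbit_conv_funpow_dist1[OF x] orb by metis
  then have eq: "funpow_dist1 \<tau> x x = n" using bij_betw_same_card[OF bij] by simp
  show "bij_betw (\<lambda>m. (\<tau> ^^ m) x) {0..<n} {1..n}" using bij unfolding eq .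
  show "(\<tau> ^^ n) x = x" using funpow_dist1_prop[OF x] unfolding eq .
qed

text \<open>Iterating the cycle from the first entry lists the whole one-line notation, which gives
  injectivity; the same listing constructs a preimage.\<close>

lemma bij_betw_one_line_cycle:
  assumes "n \<ge> 1"
  shows "bij_betw (\<lambda>\<pi>. (one_line_cycle n \<pi>, \<pi> 1)) {\<pi>. \<pi> permutes {1..n}} (cyclic_perms n \<times> {1..n})"
  unfolding bij_betw_def
proof
  show "inj_on (\<lambda>\<pi>. (one_line_cycle n \<pi>, \<pi> 1)) {\<pi>. \<pi> permutes {1..n}}"
  proof (rule inj_onI)
    fix \<pi> \<rho> assume "\<pi> \<in> {\<pi>. \<pi> permutes {1..n}}" "\<rho> \<in> {\<pi>. \<pi> permutes {1..n}}"
      and eq: "(one_line_cycle n \<pi>, \<pi> 1) = (one_line_cycle n \<rho>, \<rho> 1)"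
    then have p: "\<pi> permutes {1..n}" "\<rho> permutes {1..n}" by auto
    have ent: "entry n \<pi> i = entry n \<rho> i" for i
      using eq funpow_one_line_cycle[OF assms p(1)] funpow_one_line_cycle[OF assms p(2)]
      by (metis prod.inject)
    show "\<pi> = \<rho>"
    proof
      fix i
      show "\<pi> i = \<rho> i"
      proof (cases "i \<in> {1..n}")
        case True
        then show ?thesis using ent[of "i - 1"] by (auto simp: entry_def)
      next
        case False
        then show ?thesis using p by (metis permutes_not_in)
      qed
    qed
  qed
next
  show "(\<lambda>\<pi>. (one_line_cycle n \<pi>, \<pi> 1)) ` {\<pi>. \<pi> permutes {1..n}} = cyclic_perms n \<times> {1..n}"
  proof (intro equalityI subsetI)
    fix y assume "y \<in> (\<lambda>\<pi>. (one_line_cycle n \<pi>, \<pi> 1)) ` {\<pi>. \<pi> permutes {1..n}}"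
    then obtain \<pi> where \<pi>: "\<pi> permutes {1..n}" "y = (one_line_cycle n \<pi>, \<pi> 1)" by auto
    have "\<pi> 1 \<in> {1..n}" using entry_in[OF assms \<pi>(1), of 0] by (simp add: entry_def)
    then show "y \<in> cyclic_perms n \<times> {1..n}"
      using one_line_cycle_in_cyclic_perms[OF assms \<pi>(1)] \<pi>(2) by simp
  next
    fix y assume "y \<in> cyclic_perms n \<times> {1..n}"
    then obtain \<tau> x where y: "y = (\<tau>, x)" and \<tau>: "\<tau> \<in> cyclic_perms n" and x: "x \<in> {1..n}" by auto
    note pow = cyclic_perm_funpow[OF \<tau> x]
    \<comment> \<open>Entry 1 is the starting value itself, hence the exponent \<open>i - 1\<close>;
      the identity outside \<open>{1..n}\<close> is what \<open>permutes\<close> demands.\<close>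
    define \<pi> where "\<pi> i = (if i \<in> {1..n} then (\<tau> ^^ (i - 1)) x else i)" for i
    have "bij_betw (\<lambda>i. i - 1) {1..n} {0..<n}"
      by (rule bij_betwI[where g = Suc]) auto
    then have "bij_betw (\<lambda>i. (\<tau> ^^ (i - 1)) x) {1..n} {1..n}"
      using bij_betw_trans[OF _ pow(1)] by (simp add: comp_def)
    then have "bij_betw \<pi> {1..n} {1..n}"
      using bij_betw_cong[of "{1..n}" \<pi> "\<lambda>i. (\<tau> ^^ (i - 1)) x"] by (simp add: \<pi>_def)
    then have \<pi>: "\<pi> permutes {1..n}"
      by (rule bij_imp_permutes) (simp only: \<pi>_def if_False)
    have ent: "entry n \<pi> i = (\<tau> ^^ i) x" for i
    proof -
      have "entry n \<pi> i = (\<tau> ^^ (i mod n)) x"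
        using assms by (simp add: entry_def \<pi>_def Suc_leI)
      then show ?thesis using funpow_mod_eq[OF pow(2)] by simp
    qed
    have "one_line_cycle n \<pi> = \<tau>"
    proof
      fix a
      show "one_line_cycle n \<pi> a = \<tau> a"
      proof (cases "a \<in> {1..n}")
        case True
        then obtain i where "entry n \<pi> i = a" using entry_surj[OF assms \<pi>] by metis
        then show ?thesis using one_line_cycle_entry[OF assms \<pi>, of i] by (simp add: ent)
      next
        case False
        then show ?thesis using \<tau>
          by (metis (no_types, lifting) cyclic_perms_def mem_Collect_eq one_line_cycle_def permutes_not_in)
      qed
    qed
    moreover have "\<pi> 1 = x" using assms by (simp add: \<pi>_def)
    ultimately show "y \<in> (\<lambda>\<pi>. (one_line_cycle n \<pi>, \<pi> 1)) ` {\<pi>. \<pi> permutes {1..n}}"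
      using y \<pi> by blast
  qed
qed

text \<open>The summand ignores the starting value, so reindexing along the bijection produces the
  factor \<open>n\<close>.\<close>

lemma sum_one_line_cycle:
  fixes g :: "(nat \<Rightarrow> nat) \<Rightarrow> nat"
  assumes "n \<ge> 1"
  shows "(\<Sum>\<pi> | \<pi> permutes {1..n}. g (one_line_cycle n \<pi>)) = n * (\<Sum>\<tau>\<in>cyclic_perms n. g \<tau>)"
proof -
  have "(\<Sum>\<pi> | \<pi> permutes {1..n}. g (one_line_cycle n \<pi>))
      = (\<Sum>y\<in>cyclic_perms n \<times> {1..n}. g (fst y))"
    using sum.reindex_bij_betw[OF bij_betw_one_line_cycle[OF assms], of "\<lambda>y. g (fst y)"] by simp
  also have "\<dots> = (\<Sum>\<tau>\<in>cyclic_perms n. \<Sum>x\<in>{1..n}. g \<tau>)"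
    by (simp add: sum.cartesian_product split_def del: sum_constant)
  finally show ?thesis by (simp add: sum_distrib_left)
qed

text \<open>Cycles are grouped by their number of ascents plus one; the vanishing of
  \<open>g\<close> beyond \<open>k\<close> truncates the sum.\<close>

lemma sum_cyclic_perms_by_ascents:
  fixes g :: "nat \<Rightarrow> nat"
  assumes "\<And>i. i > k \<Longrightarrow> g i = 0"
  shows "(\<Sum>\<tau>\<in>cyclic_perms n. g (card (ascents n \<tau>) + 1)) = (\<Sum>i=1..k. cyc_asc n i * g i)"
proof -
  let ?a = "\<lambda>\<tau>. card (ascents n \<tau>) + 1"
  let ?S = "{\<tau> \<in> cyclic_perms n. ?a \<tau> \<in> {1..k}}"
  have "(\<Sum>\<tau>\<in>cyclic_perms n. g (?a \<tau>)) = (\<Sum>\<tau>\<in>?S. g (?a \<tau>))"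
    by (rule sum.mono_neutral_right[OF finite_cyclic_perms]) (use assms in \<open>auto simp: not_le\<close>)
  also have "\<dots> = (\<Sum>i\<in>{1..k}. \<Sum>\<tau> | \<tau> \<in> ?S \<and> ?a \<tau> = i. g (?a \<tau>))"
    by (rule sum.group[symmetric]) (use finite_cyclic_perms in auto)
  also have "\<dots> = (\<Sum>i=1..k. cyc_asc n i * g i)"
  proof (rule sum.cong[OF refl])
    fix i assume i: "i \<in> {1..k}"
    then have "{\<tau>. \<tau> \<in> ?S \<and> ?a \<tau> = i}
        = {\<tau>. \<tau> permutes {1..n} \<and> cyclic_on \<tau> {1..n} \<and> ?a \<tau> = i}"
      by (auto simp: cyclic_perms_def)
    then show "(\<Sum>\<tau> | \<tau> \<in> ?S \<and> ?a \<tau> = i. g (?a \<tau>)) = cyc_asc n i * g i"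
      by (simp add: cyc_asc_def)
  qed
  finally show ?thesis .
qed

text \<open>Without ascents, \<open>\<tau>\<close> exchanges \<open>1\<close> and \<open>n\<close>, which is already a full cycle.\<close>

lemma cyc_asc_1:
  assumes "n \<ge> 3"
  shows "cyc_asc n 1 = 0"
proof -
  have False if \<tau>: "\<tau> permutes {1..n}" "cyclic_on \<tau> {1..n}" "card (ascents n \<tau>) = 0" for \<tau>
  proof -
    have "finite (ascents n \<tau>)" by (simp add: ascents_def)
    then have "ascents n \<tau> = {}" using \<tau>(3) by simp
    then have "\<not> \<tau> c < \<tau> (c + 1)" if "1 \<le> c" "c < n" for c
      using that by (auto simp: ascents_def)
    moreover have "\<tau> c \<noteq> \<tau> (c + 1)" for c
      using permutes_inj[OF \<tau>(1)] by (simp add: inj_eq)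
    ultimately have "\<tau> (c + 1) < \<tau> c" if "1 \<le> c" "c < n" for c
      using that by (meson linorder_neqE_nat)
    then have anti: "\<tau> b < \<tau> a" if "1 \<le> a" "a < b" "b \<le> n" for a b
      by (rule steps_strict_antimono_on_interval[where f = \<tau> and a = a and b = b]) (use that in auto)
    have mem: "\<tau> a \<in> {1..n}" if "a \<in> {1..n}" for a
      using \<tau>(1) that by (simp only: permutes_in_image)
    have preimage: "\<exists>a\<in>{1..n}. \<tau> a = b" if "b \<in> {1..n}" for b
      using that permutes_image[OF \<tau>(1)] by (metis imageE)
    \<comment> \<open>A strictly decreasing permutation attains its maximum at 1 and its minimum at
      \<open>n\<close>.\<close>
    obtain a where "a \<in> {1..n}" "\<tau> a = n" using preimage[of n] assms by auto
    then have "\<tau> 1 = n" using anti[of 1 a] mem[of 1] assms by (cases "a = 1") auto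
    obtain b where "b \<in> {1..n}" "\<tau> b = 1" using preimage[of 1] assms by auto
    then have "\<tau> n = 1" using anti[of b n] mem[of n] assms by (cases "b = n") auto
    have "orbit \<tau> 1 \<subseteq> {1, n}"
    proof
      fix y assume "y \<in> orbit \<tau> 1"
      then show "y \<in> {1, n}"
        by induction (use \<open>\<tau> 1 = n\<close> \<open>\<tau> n = 1\<close> in auto)
    qed
    moreover have "orbit \<tau> 1 = {1..n}" using \<tau>(2) assms by (intro orbit_cyclic_eq3) auto
    moreover have "2 \<in> {1..n}" using assms by simp
    ultimately have "2 \<in> {1, n}" by blast
    then show False using assms by simp
  qed
  then have "{\<tau>. \<tau> permutes {1..n} \<and> cyclic_on \<tau> {1..n} \<and> card (ascents n \<tau>) + 1 = 1} = {}"
    by auto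
  then show ?thesis unfolding cyc_asc_def by (simp only: card.empty)
qed

section \<open>Summation over patterns\<close>

lemma Pi_perm_eq_iff:
  assumes "u \<in> primitive_words k n"
  shows "Pi_perm \<sigma> n (cycle u) = \<pi> \<longleftrightarrow> is_pattern \<sigma> n (cycle u) \<pi>"
proof -
  have "cycle u \<in> periodic_words k n"
    using assms by (auto simp: periodic_words_def primitive_words_def)
  then show ?thesis
    unfolding Pi_perm_def using theI'[OF ex1_is_pattern] the1_equality[OF ex1_is_pattern] by blast
qed

lemma periodic_words_eq: "periodic_words k n = cycle ` primitive_words k n"
  by (auto simp: periodic_words_def primitive_words_def)

text \<open>Each primitive word has exactly one pattern, so the fibres of \<open>Pi_perm\<close>
  partition the words, for any signature.\<close>

lemma card_primitive_words_eq_sum_patterns: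
  "card (primitive_words k n)
     = (\<Sum>\<pi> | \<pi> permutes {1..n}. card {u \<in> primitive_words k n. is_pattern \<sigma> n (cycle u) \<pi>})"
proof -
  let ?h = "\<lambda>u. Pi_perm \<sigma> n (cycle u)"
  have "?h ` primitive_words k n \<subseteq> {\<pi>. \<pi> permutes {1..n}}"
    using Pi_perm_eq_iff[THEN iffD1, OF _ refl] unfolding is_pattern_def by blast
  then have "card (primitive_words k n)
      = (\<Sum>\<pi> | \<pi> permutes {1..n}. card {u \<in> primitive_words k n. ?h u = \<pi>})"
    using sum.group[of "primitive_words k n" "{\<pi>. \<pi> permutes {1..n}}" ?h "\<lambda>_. 1::nat"]
    by (simp add: finite_primitive_words finite_permutations)
  moreover have "{u \<in> primitive_words k n. ?h u = \<pi>}
      = {u \<in> primitive_words k n. is_pattern \<sigma> n (cycle u) \<pi>}" for \<pi>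
    using Pi_perm_eq_iff by blast
  ultimately show ?thesis by simp
qed

text \<open>Primitive words are counted twice: by Moebius inversion, and by pattern with the
  patterns collected according to their cycles.\<close>

lemma lyndon_count_eq_sum_cyc_asc:
  assumes "n \<ge> 1" "n mod 4 \<noteq> 2"
  shows "lyndon_count k n = (\<Sum>i=1..k. real (cyc_asc n i) * real ((n + k - i) choose n))"
proof -
  have "card (primitive_words k n)
      = (\<Sum>\<pi> | \<pi> permutes {1..n}. (n + k - (card (ascents n (one_line_cycle n \<pi>)) + 1)) choose n)"
    unfolding card_primitive_words_eq_sum_patterns[of k n "reverse_signature k"]
    using card_words_with_pattern[OF assms(1) _ assms(2)] by (intro sum.cong) auto
  also have "\<dots> = n * (\<Sum>\<tau>\<in>cyclic_perms n. (n + k - (card (ascents n \<tau>) + 1)) choose n)"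
    by (rule sum_one_line_cycle[OF assms(1)])
  also have "\<dots> = n * (\<Sum>i=1..k. cyc_asc n i * ((n + k - i) choose n))"
    \<comment> \<open>For \<open>i > k\<close> the upper index falls below \<open>n\<close>, also
      where the subtraction truncates to 0, since \<open>n \<ge> 1\<close>.\<close>
    by (subst sum_cyclic_perms_by_ascents[where g = "\<lambda>i. (n + k - i) choose n" and k = k])
       (use assms(1) in auto)
  finally have "real (card (primitive_words k n))
      = real n * real (\<Sum>i=1..k. cyc_asc n i * ((n + k - i) choose n))"
    by (simp only: of_nat_mult)
  then have "real n * lyndon_count k n
      = real n * real (\<Sum>i=1..k. cyc_asc n i * ((n + k - i) choose n))"
    using card_primitive_words[of n k] assms(1) by simp
  then show ?thesis using assms(1) by simp
qed

text \<open>A permutation is realized iff the binomial number of its words is nonzero, that is, iff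
  its cycle has at most \<open>k - 1\<close> ascents. Division by \<open>n\<close> cancels the
  choice of starting value.\<close>

lemma num_patterns_reverse:
  assumes "n \<ge> 1" "n mod 4 \<noteq> 2" "k \<ge> 1"
  shows "num_patterns (reverse_signature k) n = (\<Sum>i=1..k. real (cyc_asc n i))"
proof -
  let ?\<sigma> = "reverse_signature k"
  let ?W = "\<lambda>\<pi>. {u \<in> primitive_words k n. is_pattern ?\<sigma> n (cycle u) \<pi>}"
  let ?a = "\<lambda>\<tau>. card (ascents n \<tau>) + 1"
  have "?W \<pi> \<noteq> {} \<longleftrightarrow> ?a (one_line_cycle n \<pi>) \<le> k" if "\<pi> permutes {1..n}" for \<pi>
  proof -
    have "finite (?W \<pi>)" using finite_primitive_words by simp
    then have "?W \<pi> \<noteq> {} \<longleftrightarrow> card (?W \<pi>) \<noteq> 0" by simp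
    also have "\<dots> \<longleftrightarrow> n \<le> n + k - 1 - card (ascents n (one_line_cycle n \<pi>))"
      unfolding card_words_with_pattern[OF assms(1) that assms(2)] by (simp add: not_less)
    also have "\<dots> \<longleftrightarrow> ?a (one_line_cycle n \<pi>) \<le> k" using assms(1,3) by arith
    finally show ?thesis .
  qed
  moreover have "realized_perms ?\<sigma> n = {\<pi>. \<pi> permutes {1..n} \<and> ?W \<pi> \<noteq> {}}"
  proof -
    have "realized_perms ?\<sigma> n = (\<lambda>u. Pi_perm ?\<sigma> n (cycle u)) ` primitive_words k n"
      by (simp add: realized_perms_def periodic_words_eq image_image reverse_signature_def)
    also have "\<dots> = {\<pi>. ?W \<pi> \<noteq> {}}"
      by (auto simp: image_iff Pi_perm_eq_iff[of _ k n, symmetric])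
    also have "\<dots> = {\<pi>. \<pi> permutes {1..n} \<and> ?W \<pi> \<noteq> {}}"
      unfolding is_pattern_def by blast
    finally show ?thesis .
  qed
  ultimately have "realized_perms ?\<sigma> n
      = {\<pi>. \<pi> permutes {1..n} \<and> ?a (one_line_cycle n \<pi>) \<le> k}" by auto
  then have "card (realized_perms ?\<sigma> n)
      = (\<Sum>\<pi> | \<pi> permutes {1..n}. if ?a (one_line_cycle n \<pi>) \<le> k then 1 else 0)"
    by (simp add: sum.If_cases finite_permutations Int_def)
  also have "\<dots> = n * (\<Sum>\<tau>\<in>cyclic_perms n. if ?a \<tau> \<le> k then 1 else 0)"
    by (rule sum_one_line_cycle[OF assms(1)])
  also have "\<dots> = n * (\<Sum>i=1..k. cyc_asc n i)"
    by (subst sum_cyclic_perms_by_ascents[where g = "\<lambda>i. if i \<le> k then 1 else 0" and k = k]) auto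
  finally show ?thesis using assms(1) by (simp add: num_patterns_def)
qed

theorem theorem3p11:
  fixes n k :: nat
  assumes "n \<ge> 3" and "\<not> [n = 2] (mod 4)" and "k \<ge> 3"
  shows "num_patterns (reverse_signature k) n - num_patterns (reverse_signature (k - 1)) n
           = real (cyc_asc n k)
       \<and> real (cyc_asc n k)
           = lyndon_count k n
             - (\<Sum>i = 2..k - 1. real ((n + k - i) choose (k - i)) * real (cyc_asc n i))"
proof
  have n: "n \<ge> 1" "n mod 4 \<noteq> 2" using assms by (auto simp: cong_def)
  obtain l where l: "k = Suc l" "l \<ge> 2" using assms(3) by (cases k) auto
  show "num_patterns (reverse_signature k) n - num_patterns (reverse_signature (k - 1)) n
      = real (cyc_asc n k)"
    using num_patterns_reverse[OF n] l by simp
  have "lyndon_count k n = (\<Sum>i=1..k. real (cyc_asc n i) * real ((n + k - i) choose n))"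
    by (rule lyndon_count_eq_sum_cyc_asc[OF n])
  \<comment> \<open>The term \<open>i = k\<close> has the coefficient
    \<open>n choose n = 1\<close>.\<close>
  also have "\<dots> = (\<Sum>i=1..l. real (cyc_asc n i) * real ((n + k - i) choose n)) + real (cyc_asc n k)"
    using l by simp
  \<comment> \<open>The term \<open>i = 1\<close> vanishes by \<open>cyc_asc_1\<close>, which uses
    \<open>n \<ge> 3\<close>.\<close>
  also have "(\<Sum>i=1..l. real (cyc_asc n i) * real ((n + k - i) choose n))
      = (\<Sum>i=2..l. real (cyc_asc n i) * real ((n + k - i) choose n))"
    using l cyc_asc_1[OF assms(1)] by (subst sum.atLeast_Suc_atMost) (auto simp: numeral_2_eq_2)
  also have "\<dots> = (\<Sum>i=2..k - 1. real ((n + k - i) choose (k - i)) * real (cyc_asc n i))"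
  proof (rule sum.cong)
    fix i assume "i \<in> {2..k - 1}"
    then have "n \<le> n + k - i" "n + k - i - n = k - i" by auto
    then have "(n + k - i) choose n = (n + k - i) choose (k - i)"
      using binomial_symmetric[of n "n + k - i"] by simp
    then show "real (cyc_asc n i) * real ((n + k - i) choose n)
        = real ((n + k - i) choose (k - i)) * real (cyc_asc n i)" by simp
  qed (use l in simp)
  finally show "real (cyc_asc n k) = lyndon_count k n
      - (\<Sum>i = 2..k - 1. real ((n + k - i) choose (k - i)) * real (cyc_asc n i))" by simp
qed

end
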